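(* There exists an entire function $f:\mathbb{C}\to\mathbb{C}$ such that for every $\varepsilon>0$, $$\lim_{r\to\infty} v(r,\varepsilon)=\infty\quad\text{and}\quad \lim_{r\to\infty} w(r,\varepsilon)=\infty .$$
   Context: For an entire function $f$ and $r\ge 0$ let $M(r)=M_f(r):=\max_{|z|=r}|f(z)|$. For $r,\varepsilon>0$, $v(r,\varepsilon)$ denotes the number of connected components of the set $\{z\in\mathbb{C}: |z|=r,\ |f(z)|>M(r)-\varepsilon\}$, and $w(r,\varepsilon)$ denotes the number of connected components of the set $\{z\in\mathbb{C}: |z|=r,\ |f(z)|<\varepsilon\}$. *)

theory Defs
  imports "HOL-Complex_Analysis.Complex_Analysis"
begin

definition max_modulus :: "(complex \<Rightarrow> complex) \<Rightarrow> real \<Rightarrow> real" where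
  "max_modulus f r = (SUP z\<in>sphere 0 r. norm (f z))"

text \<open>For continuous functions the supremum is attained, so it is the maximum.\<close>

lemma max_modulus_is_max:
  assumes "continuous_on (sphere 0 r) f" "0 \<le> r"
  shows "\<exists>z\<in>sphere 0 r. norm (f z) = max_modulus f r"
    and "\<And>z. z \<in> sphere 0 r \<Longrightarrow> norm (f z) \<le> max_modulus f r"
proof -
  have "compact ((\<lambda>z. norm (f z)) ` sphere 0 r)"
    using assms by (intro compact_continuous_image continuous_intros) auto
  moreover have "complex_of_real r \<in> sphere 0 r"
    using assms by simp
  then have "(\<lambda>z. norm (f z)) ` sphere 0 r \<noteq> {}"
    by blast
  ultimately obtain m where m: "m \<in> (\<lambda>z. norm (f z)) ` sphere 0 r"
      "\<forall>t\<in>(\<lambda>z. norm (f z)) ` sphere 0 r. t \<le> m"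
    using compact_attains_sup by blast
  then have "max_modulus f r = m"
    unfolding max_modulus_def by (intro cSup_eq_maximum) auto
  then show "\<exists>z\<in>sphere 0 r. norm (f z) = max_modulus f r"
    and "\<And>z. z \<in> sphere 0 r \<Longrightarrow> norm (f z) \<le> max_modulus f r"
    using m by auto
qed

text \<open>Extended-valued, because \<^const>\<open>card\<close> is 0 on infinite sets.\<close>

definition num_components :: "'a::topological_space set \<Rightarrow> enat" where
  "num_components S = (if finite (components S) then enat (card (components S)) else \<infinity>)"

definition v :: "(complex \<Rightarrow> complex) \<Rightarrow> real \<Rightarrow> real \<Rightarrow> enat" where
  "v f r \<epsilon> = num_components {z. norm z = r \<and> norm (f z) > max_modulus f r - \<epsilon>}"

definition w :: "(complex \<Rightarrow> complex) \<Rightarrow> real \<Rightarrow> real \<Rightarrow> enat" where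
  "w f r \<epsilon> = num_components {z. norm z = r \<and> norm (f z) < \<epsilon>}"

end

theory Submission
  imports Defs "HOL-Real_Asymp.Real_Asymp"
begin

text \<open>
  Let \<open>E z = \<integral>\<^sub>0\<^sup>\<infinity> exp (z t - (t + 1) ln (t + 1)) dt\<close>. This is entire, \<open>\<bar>E z\<bar> \<le> E \<bar>z\<bar>\<close>, \<open>E r \<rightarrow> \<infinity>\<close> along
  the positive axis, and \<open>E z \<rightarrow> 0\<close> as \<open>z \<rightarrow> \<infinity>\<close> outside any sector around that axis: in the left
  half-plane directly, and for \<open>\<bar>Im z\<bar> > \<pi>/2\<close> by rotating the path of integration by \<open>\<pm>\<pi>/2\<close>.

  Take \<open>f\<close> as the sum over \<open>i\<close> of \<open>\<delta>\<^sub>i\<close> times the \<open>i\<close>-th powers of \<open>i\<close> rotations of \<open>E\<close>, all rotations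
  being distinct. If \<open>\<delta>\<^sub>i\<close> is small enough, group \<open>i\<close> is negligible until its tracts are separated
  from each other and from those of the earlier groups. On a large circle \<open>\<bar>z\<bar> = r\<close> only finitely
  many groups matter; up to \<open>o(1)\<close>, in a tract of group \<open>i\<close> the maximum of \<open>\<bar>f\<bar>\<close> is \<open>\<delta>\<^sub>i E(r)\<^sup>i\<close>, and off
  all tracts \<open>f\<close> vanishes. The group with the largest \<open>\<delta>\<^sub>i E(r)\<^sup>i\<close> provides \<open>i\<close> nearly equal maxima in
  separate tracts, and points where \<open>f\<close> is small between them; its index tends to infinity because
  \<open>E(r)\<^sup>i\<close> eventually beats all lower powers.
\<close>

section \<open>An entire function with one narrow tract\<close>

text \<open>By the M-test the partial sums converge uniformly on the closed unit disc about each
  point. The index from which \<open>M\<close> dominates may depend on \<open>R\<close>.\<close>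

lemma entire_suminf:
  fixes f :: "nat \<Rightarrow> complex \<Rightarrow> complex"
  assumes "\<And>n. f n holomorphic_on UNIV"
    and bound: "\<And>R. \<forall>\<^sub>F n in sequentially. \<forall>z\<in>cball 0 R. norm (f n z) \<le> M n"
    and "summable M"
  shows "(\<lambda>z. \<Sum>n. f n z) holomorphic_on UNIV"
proof (rule holomorphic_uniform_sequence[where f = "\<lambda>n z. \<Sum>k<n. f k z"])
  show "(\<lambda>z. \<Sum>k<n. f k z) holomorphic_on UNIV" for n
    by (intro holomorphic_intros assms)
  fix z :: complex
  have "cball z 1 \<subseteq> cball 0 (norm z + 1)"
    by (metis cball_subset_cball_iff dist_0_norm dist_commute order_refl add.commute)
  then have "uniform_limit (cball z 1) (\<lambda>n z. \<Sum>k<n. f k z) (\<lambda>z. \<Sum>n. f n z) sequentially"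
    by (rule uniform_limit_on_subset[OF Weierstrass_m_test_ev[OF bound \<open>summable M\<close>]])
  then show "\<exists>d>0. cball z d \<subseteq> UNIV \<and>
      uniform_limit (cball z d) (\<lambda>n z. \<Sum>k<n. f k z) (\<lambda>z. \<Sum>n. f n z) sequentially"
    by (intro exI[of _ 1]) simp
qed auto

text \<open>This is \<open>exp (z * t)\<close> times the principal value of (t+1)^(-(t+1)). The
  variable \<open>t\<close> is complex so that the path of integration can be moved; the shift by 1
  keeps the branch point of \<open>Ln\<close> off the closed right half-plane.\<close>

definition tract_kernel :: "complex \<Rightarrow> complex \<Rightarrow> complex" where
  "tract_kernel z t = exp (z * t - (t + 1) * Ln (t + 1))"

text \<open>Cutting the half-line into unit intervals turns the improper integral into a series, to
  which the M-test applies.\<close>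

definition tract_piece :: "nat \<Rightarrow> complex \<Rightarrow> complex" where
  "tract_piece k z = integral {real k..real k + 1} (\<lambda>t. tract_kernel z (of_real t))"

definition tract_fun :: "complex \<Rightarrow> complex" where
  "tract_fun z = (\<Sum>k. tract_piece k z)"

text \<open>The exponent is sorted by \<open>Re t\<close> and \<open>Im t\<close>, so that in a
  quadrant the two parts can be estimated separately.\<close>

lemma norm_tract_kernel:
  assumes "t \<noteq> -1"
  shows "norm (tract_kernel z t) =
    exp (Re t * (Re z - ln (norm (t + 1))) - ln (norm (t + 1)) - Im t * (Im z - Im (Ln (t + 1))))"
proof -
  have "t + 1 \<noteq> 0" using assms by (simp add: add_eq_0_iff2)
  then have "Re (Ln (t + 1)) = ln (norm (t + 1))" by simp
  then show ?thesis unfolding tract_kernel_def norm_exp_eq_Re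
    by (simp add: algebra_simps)
qed

lemma tract_kernel_of_real:
  assumes "t \<ge> 0"
  shows "tract_kernel z (of_real t) = exp (z * of_real t - of_real ((t + 1) * ln (t + 1)))"
proof -
  have "Ln (complex_of_real t + 1) = of_real (ln (t + 1))"
    using assms Ln_of_real[of "t + 1"] by simp
  then show ?thesis unfolding tract_kernel_def by simp
qed

lemma norm_tract_kernel_of_real:
  assumes "t \<ge> 0"
  shows "norm (tract_kernel z (of_real t)) = exp (Re z * t - (t + 1) * ln (t + 1))"
  using assms by (simp add: tract_kernel_of_real)

lemma tract_kernel_holomorphic: "tract_kernel z holomorphic_on {t. Re t > -1}"
  unfolding tract_kernel_def
  by (intro holomorphic_intros) (auto simp: complex_nonpos_Reals_iff)

lemma continuous_on_tract_kernel_of_real: "continuous_on {0..} (\<lambda>t. tract_kernel z (of_real t))"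
  unfolding tract_kernel_def
  by (intro continuous_intros) (auto simp: complex_nonpos_Reals_iff)

lemma tract_kernel_integrable: "(\<lambda>t. tract_kernel z (of_real t)) integrable_on {real k..real k + 1}"
  by (intro integrable_continuous_real continuous_on_subset[OF continuous_on_tract_kernel_of_real]) auto

lemma tract_kernel_real_integrable:
  "(\<lambda>t. exp (x * t - (t + 1) * ln (t + 1))) integrable_on {real k..real k + 1}"
  by (intro integrable_continuous_real continuous_intros) auto

lemma tract_piece_of_real:
  "tract_piece k (of_real x) = of_real (integral {real k..real k + 1} (\<lambda>t. exp (x * t - (t + 1) * ln (t + 1))))"
proof -
  have "tract_piece k (of_real x) = integral {real k..real k + 1}
      (\<lambda>t. of_real (exp (x * t - (t + 1) * ln (t + 1))))"
    unfolding tract_piece_def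
    by (intro integral_cong)
      (simp add: tract_kernel_of_real exp_of_real[symmetric])
  also have "\<dots> = of_real (integral {real k..real k + 1} (\<lambda>t. exp (x * t - (t + 1) * ln (t + 1))))"
    using integral_linear[OF tract_kernel_real_integrable bounded_linear_of_real] by (simp add: o_def)
  finally show ?thesis .
qed

lemma norm_tract_piece_le:
  "norm (tract_piece k z) \<le> integral {real k..real k + 1} (\<lambda>t. exp (norm z * t - (t + 1) * ln (t + 1)))"
  unfolding tract_piece_def
proof (rule integral_norm_bound_integral[OF tract_kernel_integrable tract_kernel_real_integrable])
  fix t assume "t \<in> {real k..real k + 1}"
  then have "t \<ge> 0" by auto
  then show "norm (tract_kernel z (of_real t)) \<le> exp (norm z * t - (t + 1) * ln (t + 1))"
    by (auto simp: norm_tract_kernel_of_real intro!: mult_right_mono complex_Re_le_cmod)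
qed

text \<open>Once \<open>ln (t + 1) \<ge> \<bar>R\<bar> + 1\<close>, the term
  \<open>(t + 1) * ln (t + 1)\<close> absorbs \<open>\<bar>R\<bar> * t\<close> and leaves an
  exponent of at most \<open>- k\<close>; finally \<open>exp 1 \<ge> 2\<close>.\<close>

lemma eventually_norm_tract_piece_le:
  "\<forall>\<^sub>F k in sequentially. \<forall>z\<in>cball 0 R. norm (tract_piece k z) \<le> (1/2) ^ k"
proof -
  have "\<forall>\<^sub>F k in sequentially. real k \<ge> exp (\<bar>R\<bar> + 1)"
    using filterlim_real_sequentially filterlim_at_top by blast
  then show ?thesis
  proof eventually_elim
    case (elim k)
    show ?case
    proof
      fix z assume z: "z \<in> cball (0::complex) R"
      have "norm (tract_piece k z) \<le> integral {real k..real k + 1} (\<lambda>t. exp (norm z * t - (t + 1) * ln (t + 1)))"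
        by (rule norm_tract_piece_le)
      also have "\<dots> \<le> integral {real k..real k + 1} (\<lambda>t. exp (- real k))"
      proof (rule integral_le[OF tract_kernel_real_integrable])
        fix t assume t: "t \<in> {real k..real k + 1}"
        have "\<bar>R\<bar> + 1 \<le> ln (t + 1)"
          using elim t by (subst ln_ge_iff) (auto intro: less_le_trans[OF exp_gt_zero])
        then have "(t + 1) * ln (t + 1) \<ge> (t + 1) * (\<bar>R\<bar> + 1)" using t by (intro mult_left_mono) auto
        moreover have "norm z * t \<le> \<bar>R\<bar> * t" using z t by (intro mult_right_mono) auto
        moreover have "(t + 1) * (\<bar>R\<bar> + 1) = \<bar>R\<bar> * t + t + \<bar>R\<bar> + 1"
          by (simp add: algebra_simps)
        moreover have "t \<ge> real k" using t by simp
        ultimately have "norm z * t - (t + 1) * ln (t + 1) \<le> - real k" by linarith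
        then show "exp (norm z * t - (t + 1) * ln (t + 1)) \<le> exp (- real k)" by simp
      qed auto
      also have "\<dots> = exp (-1) ^ k" using exp_of_nat_mult[of k "-1::real"] by simp
      also have "\<dots> \<le> (1/2) ^ k"
        using exp_ge_add_one_self[of "1::real"] by (intro power_mono) (auto simp: exp_minus field_simps)
      finally show "norm (tract_piece k z) \<le> (1/2) ^ k" .
    qed
  qed
qed

lemma tract_piece_holomorphic: "tract_piece k holomorphic_on UNIV"
proof -
  have "(\<lambda>z. integral (cbox (real k) (real k + 1)) (\<lambda>t. tract_kernel z (of_real t))) holomorphic_on UNIV"
  proof (rule leibniz_rule_holomorphic)
    show "((\<lambda>z. tract_kernel z (of_real t)) has_field_derivative (of_real t * tract_kernel z (of_real t))) (at z within UNIV)"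
      for z t unfolding tract_kernel_def by (auto intro!: derivative_eq_intros)
    show "(\<lambda>t. tract_kernel z (of_real t)) integrable_on cbox (real k) (real k + 1)" for z
      using tract_kernel_integrable by simp
    show "continuous_on (UNIV \<times> cbox (real k) (real k + 1)) (\<lambda>(z, t). of_real t * tract_kernel z (of_real t))"
      unfolding tract_kernel_def case_prod_beta
      by (intro continuous_intros) (auto simp: complex_nonpos_Reals_iff)
  qed auto
  then show ?thesis by (simp add: tract_piece_def[abs_def])
qed

lemma tract_fun_holomorphic: "tract_fun holomorphic_on UNIV"
  unfolding tract_fun_def[abs_def]
  by (rule entire_suminf[OF tract_piece_holomorphic eventually_norm_tract_piece_le])
    (simp add: summable_geometric)

lemma summable_tract_piece: "summable (\<lambda>k. tract_piece k z)" and summable_norm_tract_piece: "summable (\<lambda>k. norm (tract_piece k z))"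
proof -
  have "\<forall>\<^sub>F k in sequentially. norm (norm (tract_piece k z)) \<le> (1/2) ^ k"
    using eventually_norm_tract_piece_le[of "norm z"] by eventually_elim auto
  then show "summable (\<lambda>k. norm (tract_piece k z))"
    by (rule summable_comparison_test_ev) (simp add: summable_geometric)
  then show "summable (\<lambda>k. tract_piece k z)" by (rule summable_norm_cancel)
qed

lemma partial_sums_tract_fun: "(\<lambda>n. \<Sum>k<n. tract_piece k z) \<longlonglongrightarrow> tract_fun z"
  unfolding tract_fun_def by (rule summable_LIMSEQ[OF summable_tract_piece])

text \<open>This leads back from the series to integrals over finite intervals, whose paths can be
  deformed.\<close>

lemma sum_tract_piece: "(\<Sum>k<n. tract_piece k z) = integral {0..real n} (\<lambda>t. tract_kernel z (of_real t))"
proof (induction n)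
  case (Suc n)
  have "integral {0..real n} (\<lambda>t. tract_kernel z (of_real t)) + integral {real n..real (Suc n)} (\<lambda>t. tract_kernel z (of_real t))
     = integral {0..real (Suc n)} (\<lambda>t. tract_kernel z (of_real t))"
    by (intro Henstock_Kurzweil_Integration.integral_combine integrable_continuous_real
        continuous_on_subset[OF continuous_on_tract_kernel_of_real]) auto
  then show ?case using Suc by (simp add: tract_piece_def add.commute)
qed simp

section \<open>Growth along the positive axis\<close>

lemma norm_tract_piece_of_real:
  "norm (tract_piece k (of_real x)) = integral {real k..real k + 1} (\<lambda>t. exp (x * t - (t + 1) * ln (t + 1)))"
  by (simp add: tract_piece_of_real integral_nonneg[OF tract_kernel_real_integrable])

text \<open>The kernel is positive for real \<open>x\<close>, so nothing cancels in the
  series.\<close>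

lemma norm_tract_fun_of_real: "norm (tract_fun (of_real x)) = (\<Sum>k. norm (tract_piece k (of_real x)))"
proof -
  have "tract_fun (of_real x) = (\<Sum>k. of_real (norm (tract_piece k (of_real x))))"
    unfolding tract_fun_def norm_tract_piece_of_real by (simp only: tract_piece_of_real)
  also have "\<dots> = of_real (\<Sum>k. norm (tract_piece k (of_real x)))"
    by (rule suminf_of_real[symmetric, OF summable_norm_tract_piece])
  finally show ?thesis by (simp add: suminf_nonneg[OF summable_norm_tract_piece])
qed

lemma norm_tract_fun_le: "norm (tract_fun z) \<le> norm (tract_fun (of_real (norm z)))"
proof -
  have "norm (tract_fun z) \<le> (\<Sum>k. norm (tract_piece k z))"
    unfolding tract_fun_def by (rule summable_norm[OF summable_norm_tract_piece])
  also have "\<dots> \<le> (\<Sum>k. norm (tract_piece k (of_real (norm z))))"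
    by (intro suminf_le summable_norm_tract_piece) (metis norm_tract_piece_le norm_tract_piece_of_real)
  finally show ?thesis by (simp add: norm_tract_fun_of_real)
qed

text \<open>One piece suffices, as all pieces are nonnegative at real arguments. On the interval
  from 1 to 2 the factor \<open>exp (x * t)\<close> is at least \<open>exp x\<close>, while
  \<open>(t + 1) * ln (t + 1)\<close> is at most \<open>3 * ln 3\<close>.\<close>

lemma filterlim_norm_tract_fun_of_real:
  "filterlim (\<lambda>x. norm (tract_fun (of_real x))) at_top at_top"
proof (rule filterlim_at_top_mono)
  show "filterlim (\<lambda>x. exp x * exp (- (3 * ln 3)) :: real) at_top at_top"
    by (rule filterlim_at_top_mult_tendsto_pos[OF tendsto_const]) (auto simp: exp_at_top)
  show "\<forall>\<^sub>F x in at_top. exp x * exp (- (3 * ln 3)) \<le> norm (tract_fun (of_real x))"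
    using eventually_ge_at_top[of 0]
  proof eventually_elim
    case (elim x)
    have "exp x * exp (- (3 * ln 3)) = integral {real 1..real 1 + 1} (\<lambda>t. exp x * exp (- (3 * ln 3)))"
      by simp
    also have "\<dots> \<le> integral {real 1..real 1 + 1} (\<lambda>t. exp (x * t - (t + 1) * ln (t + 1)))"
    proof (rule integral_le[OF _ tract_kernel_real_integrable])
      fix t assume t: "t \<in> {real 1..real 1 + 1}"
      have "(t + 1) * ln (t + 1) \<le> 3 * ln 3" using t by (intro mult_mono) auto
      moreover have "x * 1 \<le> x * t" using t elim by (intro mult_left_mono) auto
      ultimately show "exp x * exp (- (3 * ln 3)) \<le> exp (x * t - (t + 1) * ln (t + 1))"
        unfolding exp_add[symmetric] by simp
    qed auto
    also have "\<dots> = norm (tract_piece 1 (of_real x))" by (simp only: norm_tract_piece_of_real)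
    also have "\<dots> \<le> (\<Sum>k. norm (tract_piece k (of_real x)))"
      using sum_le_suminf[OF summable_norm_tract_piece, of "{1}"] by simp
    finally show ?case by (simp add: norm_tract_fun_of_real)
  qed
qed

section \<open>Decay away from the positive axis\<close>

lemma integral_exp_neg_le:
  fixes c b :: real
  assumes "c > 0" "b \<ge> 0"
  shows "integral {0..b} (\<lambda>t. exp (- c * t)) \<le> 1 / c"
proof -
  have "((\<lambda>t. exp (- c * t)) has_integral (- exp (- c * b) / c - - exp (- c * 0) / c)) {0..b}"
    using assms
    by (intro fundamental_theorem_of_calculus)
      (auto simp flip: has_real_derivative_iff_has_vector_derivative intro!: derivative_eq_intros)
  then show ?thesis
    using assms by (simp add: integral_unique divide_right_mono)
qed

text \<open>The vanishing error \<open>\<delta>\<close> makes room for the chord that closes a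
  rotated path of integration.\<close>

lemma norm_tract_fun_le_of_partial:
  assumes "\<forall>\<^sub>F n in sequentially. norm (integral {0..real n} (\<lambda>t. tract_kernel z (of_real t))) \<le> B + \<delta> n"
    and "\<delta> \<longlonglongrightarrow> 0"
  shows "norm (tract_fun z) \<le> B"
proof (rule tendsto_le[OF trivial_limit_sequentially])
  show "(\<lambda>n. norm (\<Sum>k<n. tract_piece k z)) \<longlonglongrightarrow> norm (tract_fun z)"
    by (intro tendsto_norm partial_sums_tract_fun)
  show "(\<lambda>n. B + \<delta> n) \<longlonglongrightarrow> B"
    using tendsto_add[OF tendsto_const assms(2)] by simp
  show "\<forall>\<^sub>F n in sequentially. norm (\<Sum>k<n. tract_piece k z) \<le> B + \<delta> n"
    using assms(1) by (simp only: sum_tract_piece)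
qed

text \<open>Here \<open>exp (Re z * t)\<close> alone gives convergence; the other factor of the
  kernel is at most 1.\<close>

lemma norm_tract_fun_left:
  assumes "Re z < 0"
  shows "norm (tract_fun z) \<le> 1 / (- Re z)"
proof (rule norm_tract_fun_le_of_partial[where \<delta> = "\<lambda>_. 0"])
  have "norm (integral {0..real n} (\<lambda>t. tract_kernel z (of_real t))) \<le> 1 / (- Re z)" for n
  proof -
    have "norm (integral {0..real n} (\<lambda>t. tract_kernel z (of_real t)))
        \<le> integral {0..real n} (\<lambda>t. exp (- (- Re z) * t))"
      by (intro integral_norm_bound_integral integrable_continuous_real continuous_intros
          continuous_on_subset[OF continuous_on_tract_kernel_of_real])
        (auto simp: norm_tract_kernel_of_real)
    also have "\<dots> \<le> 1 / (- Re z)"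
      using assms by (intro integral_exp_neg_le) auto
    finally show ?thesis .
  qed
  then show "\<forall>\<^sub>F n in sequentially. norm (integral {0..real n} (\<lambda>t. tract_kernel z (of_real t))) \<le> 1 / (- Re z) + 0"
    by simp
qed simp

text \<open>In the closed first quadrant \<open>t + 1\<close> has modulus at least 1 and positive
  real part; the latter bounds its argument by \<open>pi / 2\<close>, the source of this
  constant.\<close>

lemma norm_tract_kernel_quadrant_le:
  assumes "Re t \<ge> 0" "Im t \<ge> 0"
  shows "norm (tract_kernel z t) \<le> exp (Re t * (Re z - ln (norm (t + 1))) - Im t * (Im z - pi / 2))"
proof -
  have "t \<noteq> -1" using assms by auto
  have "norm (t + 1) \<ge> 1"
    using assms abs_Re_le_cmod[of "t + 1"] by simp
  then have ln: "ln (norm (t + 1)) \<ge> 0" by simp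
  have "\<bar>Im (Ln (t + 1))\<bar> < pi / 2"
    using assms by (subst Re_Ln_pos_lt) (auto simp: complex_eq_iff)
  then have "Im t * Im (Ln (t + 1)) \<le> Im t * (pi / 2)"
    using assms by (intro mult_left_mono) auto
  with ln show ?thesis
    by (simp add: norm_tract_kernel[OF \<open>t \<noteq> -1\<close>] right_diff_distrib)
qed

text \<open>The path of integration is rotated from the positive real to the positive imaginary axis.\<close>

lemma norm_tract_fun_upper:
  assumes "Im z > pi / 2"
  shows "norm (tract_fun z) \<le> 1 / (Im z - pi / 2)"
proof (rule norm_tract_fun_le_of_partial)
  define c where "c = Im z - pi / 2"
  have c: "c > 0" using assms by (simp add: c_def)
  \<comment> \<open>A primitive on a convex domain replaces Cauchy's theorem: integrals along the
    two axes become differences of values of \<open>G\<close>.\<close>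
  obtain G where G: "(G has_field_derivative tract_kernel z t) (at t)" if "Re t > -1" for t
  proof -
    have "convex {t. Re t > -1}" "open {t. Re t > -1}"
      by (auto simp: convex_halfspace_Re_gt open_halfspace_Re_gt)
    then obtain g where "\<And>t. t \<in> {t. Re t > -1} \<Longrightarrow> (g has_field_derivative tract_kernel z t) (at t within {t. Re t > -1})"
      using holomorphic_convex_primitive'[OF _ _ tract_kernel_holomorphic] by blast
    moreover have "at t within {t. Re t > -1} = at t" if "Re t > -1" for t
      using that \<open>open {t. Re t > -1}\<close> by (intro at_within_open) auto
    ultimately have "(g has_field_derivative tract_kernel z t) (at t)" if "Re t > -1" for t
      using that by (metis mem_Collect_eq)
    then show ?thesis by (rule that)
  qed
  have real_axis: "integral {0..real n} (\<lambda>t. tract_kernel z (of_real t)) = G (of_real (real n)) - G (of_real 0)" for n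
  proof (intro integral_unique fundamental_theorem_of_calculus)
    fix t assume "t \<in> {0..real n}"
    then have "(G \<circ> of_real has_vector_derivative 1 * tract_kernel z (of_real t)) (at t)"
      by (intro field_vector_diff_chain_at G) (auto intro!: derivative_eq_intros)
    then show "((\<lambda>t. G (of_real t)) has_vector_derivative tract_kernel z (of_real t)) (at t within {0..real n})"
      by (auto simp: o_def intro: has_vector_derivative_at_within)
  qed auto
  have imag_axis: "norm (G (\<i> * of_real (real n)) - G 0) \<le> 1 / c" for n
  proof -
    have hi: "((\<lambda>t. \<i> * tract_kernel z (\<i> * of_real t)) has_integral
        (G (\<i> * of_real (real n)) - G (\<i> * of_real 0))) {0..real n}"
    proof (intro fundamental_theorem_of_calculus)
      fix t assume "t \<in> {0..real n}"
      have "((\<lambda>t. \<i> * of_real t) has_vector_derivative \<i>) (at t)"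
        by (auto intro!: derivative_eq_intros)
      then have "(G \<circ> (\<lambda>t. \<i> * of_real t) has_vector_derivative \<i> * tract_kernel z (\<i> * of_real t)) (at t)"
        by (intro field_vector_diff_chain_at G) auto
      then show "((\<lambda>t. G (\<i> * of_real t)) has_vector_derivative \<i> * tract_kernel z (\<i> * of_real t)) (at t within {0..real n})"
        by (auto simp: o_def intro: has_vector_derivative_at_within)
    qed auto
    then have "norm (G (\<i> * of_real (real n)) - G (\<i> * of_real 0))
        = norm (integral {0..real n} (\<lambda>t. \<i> * tract_kernel z (\<i> * of_real t)))"
      by (simp only: integral_unique)
    also have "\<dots> \<le> integral {0..real n} (\<lambda>t. exp (- c * t))"
    proof (rule integral_norm_bound_integral)
      show "(\<lambda>t. \<i> * tract_kernel z (\<i> * of_real t)) integrable_on {0..real n}"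
        using hi by blast
      show "(\<lambda>t. exp (- c * t)) integrable_on {0..real n}"
        by (intro integrable_continuous_real continuous_intros)
      fix t assume "t \<in> {0..real n}"
      then show "norm (\<i> * tract_kernel z (\<i> * of_real t)) \<le> exp (- c * t)"
        using norm_tract_kernel_quadrant_le[of "\<i> * of_real t" z]
        by (simp add: norm_mult mult.commute flip: c_def)
    qed
    also have "\<dots> \<le> 1 / c" using c by (intro integral_exp_neg_le) auto
    finally show ?thesis by simp
  qed
  \<comment> \<open>The segment between the ends of the two paths contributes nothing in the
    limit.\<close>
  have chord: "norm (G (of_real (real n)) - G (\<i> * of_real (real n))) \<le> exp (- c * n) * (2 * n)"
    if n: "real n \<ge> 2 * exp (Re z + c)" for n
  proof -
    \<comment> \<open>This convex set contains the segment. On it \<open>norm t \<ge> n / 2\<close>,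
      so by the choice of \<open>n\<close> the logarithm is at least \<open>Re z + c\<close>; then
      both coordinates of \<open>t\<close> are damped at rate \<open>c\<close>, and their sum is at
      least \<open>n\<close>.\<close>
    define S where "S = {t. 0 \<le> Re t \<and> 0 \<le> Im t \<and> real n \<le> Re t + Im t}"
    have "S = {t. Re t \<ge> 0} \<inter> {t. Im t \<ge> 0} \<inter> {t. inner (1 + \<i>) t \<ge> real n}"
      by (auto simp: S_def inner_complex_def)
    then have "convex S"
      by (simp add: convex_Int convex_halfspace_Re_ge convex_halfspace_Im_ge convex_halfspace_ge)
    then have "norm (G (of_real (real n)) - G (\<i> * of_real (real n)))
        \<le> exp (- c * n) * norm (of_real (real n) - \<i> * of_real (real n))"
    proof (rule field_differentiable_bound[where f' = "tract_kernel z"])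
      fix t assume t: "t \<in> S"
      show "(G has_field_derivative tract_kernel z t) (at t within S)"
        using t by (intro has_field_derivative_at_within[OF G]) (auto simp: S_def)
      have "real n \<le> 2 * norm t"
        using t complex_Re_le_cmod[of t] abs_Im_le_cmod[of t] by (auto simp: S_def)
      also have "norm t \<le> norm (t + 1)"
        using t by (auto simp: cmod_def S_def intro!: power_mono)
      finally have *: "exp (Re z + c) \<le> norm (t + 1)" using n by simp
      then have "Re z + c \<le> ln (norm (t + 1))"
        by (subst ln_ge_iff) (auto intro: less_le_trans[OF exp_gt_zero])
      then have "Re t * (Re z - ln (norm (t + 1))) \<le> Re t * (- c)"
        using t by (intro mult_left_mono) (auto simp: S_def)
      moreover have "c * (Re t + Im t) \<ge> c * real n"
        using t c by (intro mult_left_mono) (auto simp: S_def)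
      moreover have "norm (tract_kernel z t) \<le> exp (Re t * (Re z - ln (norm (t + 1))) - Im t * c)"
        using t norm_tract_kernel_quadrant_le[of t z] by (auto simp: S_def c_def)
      ultimately show "norm (tract_kernel z t) \<le> exp (- c * n)"
        by (elim order_trans) (simp add: algebra_simps)
    qed (auto simp: S_def)
    also have "norm (of_real (real n) - \<i> * of_real (real n)) \<le> 2 * real n"
      using norm_triangle_ineq4[of "of_real (real n) :: complex" "\<i> * of_real (real n)"]
      by (simp add: norm_mult)
    finally show ?thesis by (simp add: mult_left_mono)
  qed
  have "\<forall>\<^sub>F n in sequentially. real n \<ge> 2 * exp (Re z + c)"
    using filterlim_real_sequentially filterlim_at_top by blast
  then show "\<forall>\<^sub>F n in sequentially. norm (integral {0..real n} (\<lambda>t. tract_kernel z (of_real t)))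
      \<le> 1 / (Im z - pi / 2) + exp (- c * real n) * (2 * real n)"
  proof eventually_elim
    case (elim n)
    have "G (of_real (real n)) - G 0 = (G (\<i> * of_real (real n)) - G 0)
        + (G (of_real (real n)) - G (\<i> * of_real (real n)))" by simp
    then have "norm (G (of_real (real n)) - G 0)
        \<le> norm (G (\<i> * of_real (real n)) - G 0) + norm (G (of_real (real n)) - G (\<i> * of_real (real n)))"
      by (metis norm_triangle_ineq)
    then show ?case
      using imag_axis[of n] chord[OF elim] unfolding real_axis c_def by simp
  qed
  show "(\<lambda>n. exp (- c * real n) * (2 * real n)) \<longlonglongrightarrow> 0"
    using c by real_asymp
qed

text \<open>The integration variable and the logarithm are real, so conjugation passes to
  \<open>z\<close>. This carries the estimate for the upper half-plane to the lower one.\<close>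

lemma tract_fun_cnj: "tract_fun (cnj z) = cnj (tract_fun z)"
proof -
  have "tract_piece k (cnj z) = cnj (tract_piece k z)" for k
  proof -
    have "tract_kernel (cnj z) (of_real t) = cnj (tract_kernel z (of_real t))" if "t \<in> {real k..real k + 1}" for t
      using that by (simp add: tract_kernel_of_real exp_cnj)
    then have "tract_piece k (cnj z) = integral {real k..real k + 1} (\<lambda>t. cnj (tract_kernel z (of_real t)))"
      unfolding tract_piece_def by (intro integral_cong)
    also have "\<dots> = cnj (tract_piece k z)"
      unfolding tract_piece_def
      using integral_linear[OF tract_kernel_integrable bounded_linear_cnj] by (simp add: o_def)
    finally show ?thesis .
  qed
  then show ?thesis
    unfolding tract_fun_def
    using bounded_linear.suminf[OF bounded_linear_cnj summable_tract_piece, of z] by simp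
qed

lemma tract_fun_decay:
  assumes "s > 0" "\<tau> > 0"
  obtains \<rho> where "\<And>z. norm z \<ge> \<rho> \<Longrightarrow> norm (z - of_real (norm z)) \<ge> s * norm z \<Longrightarrow> norm (tract_fun z) \<le> \<tau>"
proof
  fix z :: complex
  \<comment> \<open>The radius is chosen so that a quarter of the distance \<open>s * norm z\<close>
    is at least \<open>1 / \<tau> + pi / 2\<close>, which suffices for each half-plane
    estimate.\<close>
  assume z: "norm z \<ge> 4 * (1 / \<tau> + pi / 2) / s" and far: "norm (z - of_real (norm z)) \<ge> s * norm z"
  have d: "s * norm z / 4 \<ge> 1 / \<tau> + pi / 2"
    using z assms by (simp add: field_simps)
  have "norm z \<le> \<bar>Re z\<bar> + \<bar>Im z\<bar>" by (rule cmod_le)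
  moreover have "norm (z - of_real (norm z)) \<le> \<bar>Re z - norm z\<bar> + \<bar>Im z\<bar>"
    using cmod_le[of "z - of_real (norm z)"] by simp
  moreover have "Re z \<le> norm z" by (rule complex_Re_le_cmod)
  \<comment> \<open>If \<open>Re z \<ge> 0\<close>, the distance from \<open>z\<close> to
    \<open>norm z\<close> is at most \<open>2 * \<bar>Im z\<bar>\<close>; otherwise it is at most
    \<open>2 * \<bar>Re z\<bar> + 2 * \<bar>Im z\<bar>\<close>. Hence the divisor 4.\<close>
  ultimately consider "- Re z \<ge> s * norm z / 4" | "Im z \<ge> s * norm z / 4" | "- Im z \<ge> s * norm z / 4"
    using far by linarith
  then show "norm (tract_fun z) \<le> \<tau>"
  proof cases
    case 1
    then have "- Re z \<ge> 1 / \<tau>" using d pi_gt_zero by linarith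
    moreover have "1 / \<tau> > 0" using assms by simp
    ultimately have "- Re z > 0" by linarith
    then have "1 / (- Re z) \<le> \<tau>"
      using \<open>- Re z \<ge> 1 / \<tau>\<close> assms by (simp add: field_simps)
    then show ?thesis using norm_tract_fun_left[of z] \<open>- Re z > 0\<close> by linarith
  next
    case 2
    then have *: "Im z - pi / 2 \<ge> 1 / \<tau>" using d by linarith
    moreover have "1 / \<tau> > 0" using assms by simp
    ultimately have "Im z - pi / 2 > 0" by linarith
    then have "1 / (Im z - pi / 2) \<le> \<tau>" using * assms by (simp add: field_simps)
    then show ?thesis using norm_tract_fun_upper[of z] \<open>Im z - pi / 2 > 0\<close> by linarith
  next
    case 3
    then have *: "Im (cnj z) - pi / 2 \<ge> 1 / \<tau>" using d by simp
    moreover have "1 / \<tau> > 0" using assms by simp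
    ultimately have "Im (cnj z) - pi / 2 > 0" by linarith
    then have "1 / (Im (cnj z) - pi / 2) \<le> \<tau>" using * assms by (simp add: field_simps)
    then show ?thesis
      using norm_tract_fun_upper[of "cnj z"] \<open>Im (cnj z) - pi / 2 > 0\<close> by (simp add: tract_fun_cnj)
  qed
qed

section \<open>Counting components of subsets of circles\<close>

text \<open>The points \<open>p j\<close> lie in distinct components, because a component is itself
  a connected subset of \<open>S\<close>. With infinitely many components the count is
  \<infinity>.\<close>

lemma num_components_ge:
  assumes "finite I" "\<And>j. j \<in> I \<Longrightarrow> p j \<in> S"
    and sep: "\<And>j k C. j \<in> I \<Longrightarrow> k \<in> I \<Longrightarrow> j \<noteq> k \<Longrightarrow> connected C \<Longrightarrow> C \<subseteq> S \<Longrightarrow> p j \<in> C \<Longrightarrow> p k \<notin> C"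
  shows "enat (card I) \<le> num_components S"
proof (cases "finite (components S)")
  case True
  have "inj_on (\<lambda>j. connected_component_set S (p j)) I"
  proof (rule inj_onI, rule ccontr)
    fix j k assume jk: "j \<in> I" "k \<in> I" "j \<noteq> k"
      "connected_component_set S (p j) = connected_component_set S (p k)"
    then have "p k \<in> connected_component_set S (p j)" "p j \<in> connected_component_set S (p j)"
      using assms(2) by (auto simp: connected_component_refl_eq)
    then show False
      using sep[OF jk(1-3) connected_connected_component connected_component_subset] by blast
  qed
  moreover have "(\<lambda>j. connected_component_set S (p j)) ` I \<subseteq> components S"
    using assms(2) by (auto simp: components_def)
  ultimately have "card I \<le> card (components S)"
    using True by (rule card_inj_on_le)
  then show ?thesis using True by (simp add: num_components_def)
qed (simp add: num_components_def)

text \<open>The chord through two avoided points cuts the circle exactly there, so it separates the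
  two arcs.\<close>

lemma connected_subset_circle_avoiding:
  assumes "r > 0" "connected C" "C \<subseteq> sphere 0 r"
    and avoid: "of_real r * cis a \<notin> C" "of_real r * cis b \<notin> C"
    and x: "of_real r * cis \<phi> \<in> C" "a < \<phi>" "\<phi> < b"
    and y: "b < \<psi>" "\<psi> < a + 2 * pi"
  shows "of_real r * cis \<psi> \<notin> C"
proof
  assume yC: "of_real r * cis \<psi> \<in> C"
  \<comment> \<open>The signed distance from the chord. Its product form below is positive for
    angles strictly between \<open>a\<close> and \<open>b\<close> and negative strictly between
    \<open>b\<close> and \<open>a + 2 * pi\<close>.\<close>
  define g where "g z = Re (z * cis (- ((a + b) / 2))) - r * cos ((b - a) / 2)" for z
  have g: "g (of_real r * cis t) = 2 * r * (sin ((t - a) / 2) * sin ((b - t) / 2))" for t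
  proof -
    have "Re (of_real r * cis t * cis (- ((a + b) / 2))) = r * cos (t - (a + b) / 2)"
      by (simp add: mult.assoc cis_mult)
    moreover have "cos (t - (a + b) / 2) - cos ((b - a) / 2) = 2 * (sin ((t - a) / 2) * sin ((b - t) / 2))"
    proof -
      have "(t - (a + b) / 2 + (b - a) / 2) / 2 = (t - a) / 2"
        "((b - a) / 2 - (t - (a + b) / 2)) / 2 = (b - t) / 2"
        by (simp_all add: field_simps)
      then show ?thesis unfolding cos_diff_cos by (simp only: mult.assoc)
    qed
    ultimately show ?thesis unfolding g_def by (simp add: algebra_simps flip: right_diff_distrib)
  qed
  have "connected (g ` C)"
    unfolding g_def by (intro connected_continuous_image continuous_intros assms)
  moreover have "g (of_real r * cis \<phi>) > 0"
    unfolding g using x y \<open>r > 0\<close> by (intro mult_pos_pos sin_gt_zero) auto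
  moreover have "g (of_real r * cis \<psi>) < 0"
  proof -
    have "sin ((\<psi> - a) / 2) > 0" using x y by (intro sin_gt_zero) auto
    moreover have "sin ((\<psi> - b) / 2) > 0" using x y by (intro sin_gt_zero) auto
    then have "sin ((b - \<psi>) / 2) < 0"
      by (metis minus_diff_eq minus_divide_left neg_0_less_iff_less sin_minus)
    ultimately show ?thesis unfolding g using \<open>r > 0\<close> by (intro mult_pos_neg) auto
  qed
  \<comment> \<open>A connected set meeting both sides must meet the chord's line, which cuts the
    circle only at the two avoided points.\<close>
  ultimately have "0 \<in> g ` C"
    using x yC connectedD_interval[of "g ` C" "g (of_real r * cis \<psi>)" "g (of_real r * cis \<phi>)" 0] by auto
  then obtain z where z: "z \<in> C" "g z = 0" by auto
  have "norm z = r" using z \<open>C \<subseteq> sphere 0 r\<close> by auto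
  then have zt: "z = of_real r * cis (Arg z)" using \<open>r > 0\<close> by (metis rcis_cmod_Arg rcis_def)
  have eq: "cis u = cis t" if sin0: "sin ((u - t) / 2) = 0" for u t
  proof -
    obtain i :: int where "(u - t) / 2 = of_int i * pi" using sin0 by (auto simp: sin_zero_iff_int2)
    then have "u = t + 2 * pi * of_int i" by (simp add: algebra_simps)
    then show ?thesis by (simp add: cis_mult[symmetric] cis_multiple_2pi)
  qed
  have "sin ((Arg z - a) / 2) = 0 \<or> sin ((b - Arg z) / 2) = 0"
    using z(2) g[of "Arg z"] zt \<open>r > 0\<close> by simp
  then have "z = of_real r * cis a \<or> z = of_real r * cis b"
    using eq[of "Arg z" a] eq[of b "Arg z"] zt by metis
  then show False using avoid z by auto
qed

lemma finite_set_separated: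
  fixes A :: "'a::metric_space set"
  assumes "finite A"
  obtains s where "s > 0" "\<And>a b. a \<in> A \<Longrightarrow> b \<in> A \<Longrightarrow> a \<noteq> b \<Longrightarrow> s \<le> dist a b"
proof -
  \<comment> \<open>The extra element 1 provides a minimum when \<open>A\<close> has fewer than two
    points.\<close>
  define D where "D = insert 1 ((\<lambda>(a, b). dist a b) ` (A \<times> A - Id))"
  have "finite D" unfolding D_def using assms by auto
  then have "Min D > 0" by (subst Min_gr_iff) (auto simp: D_def)
  moreover have "Min D \<le> dist a b" if "a \<in> A" "b \<in> A" "a \<noteq> b" for a b
    using \<open>finite D\<close> that by (intro Min_le) (auto simp: D_def)
  ultimately show ?thesis by (rule that)
qed

section \<open>Superposing rotated tracts\<close>

text \<open>The pairing function makes the directions of all groups distinct. All angles lie within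
  an interval much shorter than a full turn, so they can be compared as real numbers.\<close>

definition angle :: "nat \<times> nat \<Rightarrow> real" where
  "angle p = 1 / (real (prod_encode p) + 1)"

definition dir :: "nat \<times> nat \<Rightarrow> complex" where
  "dir p = cis (angle p)"

text \<open>These rays matter for radii from \<open>\<rho> n\<close> up to
  \<open>\<rho> (Suc n)\<close>; the later groups form a small tail there.\<close>

definition active :: "nat \<Rightarrow> (nat \<times> nat) set" where
  "active n = (SIGMA i:{..n}. {..<i})"

text \<open>The power \<open>i\<close> makes every group eventually dominate all earlier ones; group 0 is empty.\<close>

definition ray_group :: "nat \<Rightarrow> complex \<Rightarrow> complex" where
  "ray_group i z = (\<Sum>j<i. tract_fun (cnj (dir (i, j)) * z) ^ i)"

lemma angle_pos: "angle p > 0" and angle_le_1: "angle p \<le> 1"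
  by (auto simp: angle_def add_nonneg_pos)

lemma angle_eq_iff: "angle p = angle q \<longleftrightarrow> p = q"
proof
  assume "angle p = angle q"
  then have "real (prod_encode p) = real (prod_encode q)"
    unfolding angle_def by (metis add_right_cancel inverse_eq_divide inverse_eq_iff_eq)
  then show "p = q" by simp
qed simp

lemma cis_inj:
  assumes "cis a = cis b" "\<bar>a - b\<bar> < 2 * pi"
  shows "a = b"
proof -
  have "cos a = cos b \<and> sin a = sin b" using assms(1) by (simp add: complex_eq_iff)
  then obtain n :: int where "a = b + 2 * pi * n" using sin_cos_eq_iff by metis
  then have "\<bar>2 * pi * n\<bar> < 2 * pi" using assms(2) by simp
  then have "\<bar>n\<bar> < 1" by (simp add: abs_mult)
  then show ?thesis using \<open>a = b + 2 * pi * n\<close> by simp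
qed

lemma finite_active: "finite (active n)"
  by (auto simp: active_def)

lemma norm_dir [simp]: "norm (dir p) = 1"
  by (simp add: dir_def)

text \<open>Rotating by \<open>cnj (dir p)\<close> takes the ray to the positive axis, where the
  decay of \<open>tract_fun\<close> is stated.\<close>

lemma norm_cnj_dir_diff: "norm (cnj (dir p) * z - of_real r) = norm (z - of_real r * dir p)"
proof -
  have "cnj (dir p) * dir p = 1"
    by (simp add: dir_def cis_cnj cis_mult)
  then have "cnj (dir p) * z - of_real r = cnj (dir p) * (z - of_real r * dir p)"
    by (simp add: algebra_simps)
  then show ?thesis by (simp add: norm_mult)
qed

lemma ray_group_holomorphic: "ray_group i holomorphic_on UNIV"
proof -
  have "(\<lambda>z. tract_fun (c * z)) holomorphic_on UNIV" for c
    using holomorphic_on_compose_gen[OF _ tract_fun_holomorphic, of "\<lambda>z. c * z" UNIV]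
    by (auto simp: o_def intro: holomorphic_intros)
  then show ?thesis unfolding ray_group_def[abs_def] by (intro holomorphic_intros)
qed

text \<open>On circles of radius at least \<open>\<rho> n\<close>, the tracts of the groups up to \<open>n\<close> lie in disjoint balls
  of relative radius \<open>s n\<close>, and rotating their axes by \<open>\<gamma> n\<close> leads out of all of these balls.\<close>

locale tract_sum =
  fixes \<delta> \<rho> s \<gamma> :: "nat \<Rightarrow> real"
  assumes gap_pos: "0 < \<gamma> n" and gap_le_1: "\<gamma> n \<le> 1"
    and gap: "p \<in> active n \<Longrightarrow> q \<in> active n \<Longrightarrow> angle p < angle q \<Longrightarrow> angle p + \<gamma> n < angle q"
    and sep_pos: "0 < s n"
    and sep_dir: "p \<in> active n \<Longrightarrow> q \<in> active n \<Longrightarrow> p \<noteq> q \<Longrightarrow> 2 * s n \<le> dist (dir p) (dir q)"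
    and sep_gap: "p \<in> active n \<Longrightarrow> q \<in> active n \<Longrightarrow> s n \<le> dist (cis (angle p + \<gamma> n)) (dir q)"
    and mono_radius: "mono \<rho>" and radius_ge: "real n \<le> \<rho> n"
    and decay: "\<rho> n \<le> norm z \<Longrightarrow> s n * norm z \<le> norm (z - of_real (norm z)) \<Longrightarrow>
      norm (tract_fun z) \<le> (1/2) ^ n / (real (card (active n)) + 1)"
    and coeff_pos: "0 < \<delta> i" and coeff_le_1: "\<delta> i \<le> 1"
    and small: "norm z \<le> \<rho> i \<Longrightarrow> \<delta> i * norm (ray_group i z) \<le> (1/2) ^ i"
begin

section \<open>The series and its approximation by finitely many tracts\<close>

definition F :: "complex \<Rightarrow> complex" where
  "F z = (\<Sum>i. of_real (\<delta> i) * ray_group i z)"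

definition summand :: "nat \<times> nat \<Rightarrow> complex \<Rightarrow> complex" where
  "summand p z = of_real (\<delta> (fst p)) * tract_fun (cnj (dir p) * z) ^ fst p"

text \<open>The maximum modulus of each summand of group \<open>i\<close> on the circle of radius
  \<open>r\<close>, attained on its axis.\<close>

definition height :: "nat \<Rightarrow> real \<Rightarrow> real" where
  "height i r = \<delta> i * norm (tract_fun (of_real r)) ^ i"

lemma F_bound: "\<forall>\<^sub>F i in sequentially. \<forall>z\<in>cball 0 R. norm (of_real (\<delta> i) * ray_group i z) \<le> (1/2) ^ i"
proof -
  have "\<forall>\<^sub>F i in sequentially. real i \<ge> R"
    using filterlim_real_sequentially filterlim_at_top by blast
  then show ?thesis
  proof eventually_elim
    case (elim i)
    show ?case
    proof
      fix z :: complex assume "z \<in> cball 0 R"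
      then have "norm z \<le> \<rho> i" using elim radius_ge[of i] by simp
      then show "norm (of_real (\<delta> i) * ray_group i z) \<le> (1/2) ^ i"
        using small[of z i] coeff_pos[of i] by (simp add: norm_mult)
    qed
  qed
qed

lemma F_holomorphic: "F holomorphic_on UNIV"
  unfolding F_def[abs_def]
  by (rule entire_suminf[OF _ F_bound])
    (auto intro!: holomorphic_intros ray_group_holomorphic simp: summable_geometric)

lemma continuous_on_F: "continuous_on A F"
  by (rule continuous_on_subset[OF holomorphic_on_imp_continuous_on[OF F_holomorphic] subset_UNIV])

lemma norm_summand_le: "norm (summand p z) \<le> height (fst p) (norm z)"
proof -
  have "norm (tract_fun (cnj (dir p) * z)) \<le> norm (tract_fun (of_real (norm z)))"
    using norm_tract_fun_le[of "cnj (dir p) * z"] by (simp add: norm_mult)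
  then show ?thesis
    unfolding summand_def height_def using coeff_pos[of "fst p"]
    by (simp add: norm_mult norm_power power_mono)
qed

lemma norm_summand_dir: "norm (summand p (of_real r * dir p)) = height (fst p) r"
proof -
  have rot: "cnj (dir p) * (of_real r * dir p) = of_real r"
    by (simp add: dir_def cis_cnj cis_mult)
  show ?thesis
    unfolding summand_def height_def norm_mult norm_power rot using coeff_pos[of "fst p"] by simp
qed

text \<open>The groups beyond \<open>n\<close> are still in their small range and contribute at most
  \<open>(1/2) ^ n\<close> by the geometric series; the active summands outside \<open>A\<close>
  contribute as much by decay. It is used with \<open>A\<close> empty off all tracts and with a
  singleton inside one.\<close>

lemma F_approx:
  assumes r: "\<rho> n \<le> norm z" "norm z < \<rho> (Suc n)" and A: "A \<subseteq> active n"
    and far: "\<And>p. p \<in> active n - A \<Longrightarrow> s n * norm z \<le> dist z (of_real (norm z) * dir p)"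
  shows "norm (F z - (\<Sum>p\<in>A. summand p z)) \<le> 2 * (1/2) ^ n"
proof -
  have tail_bound: "norm (of_real (\<delta> i) * ray_group i z) \<le> (1/2) ^ i" if "i > n" for i
  proof -
    have "\<rho> (Suc n) \<le> \<rho> i" using that monoD[OF mono_radius] by simp
    then show ?thesis using small[of z i] coeff_pos[of i] r by (simp add: norm_mult)
  qed
  have summ: "summable (\<lambda>i. of_real (\<delta> i) * ray_group i z)"
    by (rule summable_comparison_test_ev[where g = "\<lambda>i. (1/2) ^ i"])
      (auto simp: summable_geometric eventually_at_top_linorder intro!: exI[of _ "Suc n"] tail_bound)
  have "F z = (\<Sum>i. of_real (\<delta> (i + Suc n)) * ray_group (i + Suc n) z)
      + (\<Sum>i<Suc n. of_real (\<delta> i) * ray_group i z)"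
    unfolding F_def by (rule suminf_split_initial_segment[OF summ])
  also have "(\<Sum>i<Suc n. of_real (\<delta> i) * ray_group i z) = (\<Sum>p\<in>active n. summand p z)"
    unfolding ray_group_def summand_def active_def sum_distrib_left lessThan_Suc_atMost
    by (subst sum.Sigma) (auto simp: case_prod_beta intro!: sum.cong)
  also have "\<dots> = (\<Sum>p\<in>A. summand p z) + (\<Sum>p\<in>active n - A. summand p z)"
    using sum.subset_diff[OF A finite_active] by (simp add: add.commute)
  finally have "F z - (\<Sum>p\<in>A. summand p z) =
      (\<Sum>i. of_real (\<delta> (i + Suc n)) * ray_group (i + Suc n) z) + (\<Sum>p\<in>active n - A. summand p z)"
    by simp
  also have "norm \<dots> \<le> (1/2) ^ n + (1/2) ^ n"
  proof (intro norm_triangle_mono)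
    have geo: "(\<lambda>i. (1/2::real) ^ (i + Suc n)) sums ((1/2) ^ n)"
      using sums_mult[OF geometric_sums[of "1/2::real"], of "(1/2) ^ Suc n"]
      by (simp add: power_add mult_ac)
    show "norm (\<Sum>i. of_real (\<delta> (i + Suc n)) * ray_group (i + Suc n) z) \<le> (1/2) ^ n"
      unfolding sums_unique[OF geo]
      by (rule norm_suminf_le[OF _ sums_summable[OF geo]]) (intro tail_bound, simp)
    let ?\<tau> = "(1/2) ^ n / (real (card (active n)) + 1) :: real"
    have "norm (summand p z) \<le> ?\<tau>" if p: "p \<in> active n - A" for p
    proof -
      have "s n * norm z \<le> norm (cnj (dir p) * z - of_real (norm z))"
        using far[OF p] unfolding norm_cnj_dir_diff by (simp add: dist_norm)
      then have T: "norm (tract_fun (cnj (dir p) * z)) \<le> ?\<tau>"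
        using decay[of n "cnj (dir p) * z"] r by (simp add: norm_mult)
      have "(1/2) ^ n \<le> (1::real)" by (simp add: power_le_one)
      then have "?\<tau> \<le> 1" by (simp add: divide_le_eq add_increasing)
      then have le1: "norm (tract_fun (cnj (dir p) * z)) \<le> 1" using T by linarith
      \<comment> \<open>A power of a number below 1 is at most that number only if the exponent is
        positive; no pair in \<open>active n\<close> belongs to group 0.\<close>
      have "fst p \<ge> 1" using p by (auto simp: active_def)
      then have "norm (tract_fun (cnj (dir p) * z)) ^ fst p \<le> norm (tract_fun (cnj (dir p) * z)) ^ 1"
        using le1 by (intro power_decreasing) auto
      then have "norm (tract_fun (cnj (dir p) * z)) ^ fst p \<le> ?\<tau>" using T by simp
      moreover have "norm (summand p z) \<le> 1 * norm (tract_fun (cnj (dir p) * z)) ^ fst p"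
        unfolding summand_def norm_mult norm_power using coeff_pos[of "fst p"] coeff_le_1[of "fst p"]
        by (intro mult_right_mono) auto
      ultimately show ?thesis by simp
    qed
    then have "norm (\<Sum>p\<in>active n - A. summand p z) \<le> of_nat (card (active n - A)) * ?\<tau>"
      by (rule sum_norm_bound)
    also have "\<dots> \<le> (real (card (active n)) + 1) * ?\<tau>"
      using card_mono[OF finite_active Diff_subset[of "active n" A]]
      by (intro mult_right_mono) auto
    also have "\<dots> = (1/2) ^ n"
      by (simp add: add_nonneg_eq_0_iff)
    finally show "norm (\<Sum>p\<in>active n - A. summand p z) \<le> (1/2) ^ n" .
  qed
  finally show ?thesis by simp
qed

text \<open>Let \<open>n\<close> mark the annulus of \<open>r\<close> and let \<open>i\<close>
  maximize the height among the groups up to \<open>n\<close>. Group \<open>Suc K\<close> has one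
  more power of the large value \<open>\<mu>\<close> than the groups up to \<open>K\<close> and so
  beats them all, which forces \<open>i\<close> past \<open>K\<close>.\<close>

lemma eventually_dominant:
  "\<forall>\<^sub>F r in at_top. \<exists>n i. \<rho> n \<le> r \<and> r < \<rho> (Suc n) \<and> K \<le> i \<and> i \<le> n \<and>
     (\<forall>k\<le>n. height k r \<le> height i r) \<and> b \<le> height i r"
proof -
  define L where "L = Suc K"
  \<comment> \<open>The three lower bounds make powers increase with the exponent, let group
    \<open>L\<close> overtake the groups up to \<open>K\<close>, and lift its height to
    \<open>b\<close>.\<close>
  have "\<forall>\<^sub>F r in at_top. norm (tract_fun (of_real r)) > max 1 (max (1 / \<delta> L) (b / \<delta> L))"
    using filterlim_norm_tract_fun_of_real by (simp only: filterlim_at_top_dense)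
  then show ?thesis
    using eventually_ge_at_top[of "\<rho> L"]
  proof eventually_elim
    case (elim r)
    define \<mu> where "\<mu> = norm (tract_fun (of_real r))"
    have \<mu>: "\<mu> > 1" "\<mu> * \<delta> L > 1" "\<mu> * \<delta> L > b"
      using elim(1) coeff_pos[of L] unfolding \<mu>_def by (auto simp: divide_less_eq)
    obtain m where "r < real m" using reals_Archimedean2 by blast
    then have "r < \<rho> m" using radius_ge[of m] by simp
    define n where "n = (GREATEST n. \<rho> n \<le> r)"
    have bdd: "k \<le> m" if "\<rho> k \<le> r" for k
      using that \<open>r < \<rho> m\<close> monoD[OF mono_radius, of m k] by (cases "k \<le> m") auto
    have n: "\<rho> n \<le> r" unfolding n_def by (rule GreatestI_nat[of "\<lambda>n. \<rho> n \<le> r", OF elim(2) bdd])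
    have n_ge: "k \<le> n" if "\<rho> k \<le> r" for k
      unfolding n_def by (rule Greatest_le_nat[of "\<lambda>n. \<rho> n \<le> r", OF that bdd])
    have "r < \<rho> (Suc n)" using n_ge[of "Suc n"] by (cases "r < \<rho> (Suc n)") auto
    have "L \<le> n" using n_ge elim(2) by blast
    have "finite ((\<lambda>k. height k r) ` {..n})" "(\<lambda>k. height k r) ` {..n} \<noteq> {}" by auto
    then have "Max ((\<lambda>k. height k r) ` {..n}) \<in> (\<lambda>k. height k r) ` {..n}" by (rule Max_in)
    then obtain i where "i \<in> {..n}" and Max_i: "Max ((\<lambda>k. height k r) ` {..n}) = height i r"
      by (rule imageE)
    then have i: "i \<le> n" by simp
    have max: "height k r \<le> height i r" if "k \<le> n" for k
      unfolding Max_i[symmetric] using that by (intro Max_ge) auto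
    have L: "height L r = (\<mu> * \<delta> L) * \<mu> ^ K" by (simp add: height_def \<mu>_def L_def)
    have pow: "\<mu> ^ K \<ge> 1" using \<mu> by (simp add: one_le_power)
    have low: "height k r < height L r" if "k \<le> K" for k
    proof -
      have "height k r \<le> 1 * \<mu> ^ k"
        unfolding height_def \<mu>_def[symmetric] using coeff_le_1 \<mu> by (intro mult_right_mono) auto
      also have "\<dots> \<le> 1 * \<mu> ^ K" using that \<mu> by (simp add: power_increasing)
      also have "\<dots> < height L r" unfolding L using \<mu> pow by (intro mult_strict_right_mono) auto
      finally show ?thesis .
    qed
    have "K \<le> i" using low[of i] max[OF \<open>L \<le> n\<close>] by (cases "K \<le> i") auto
    have "\<mu> * \<delta> L * 1 \<le> height L r" unfolding L using \<mu> pow by (intro mult_left_mono) auto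
    then have "b \<le> height i r" using \<mu> max[OF \<open>L \<le> n\<close>] by linarith
    then show ?case
      using n \<open>r < \<rho> (Suc n)\<close> \<open>K \<le> i\<close> i max by blast
  qed
qed

section \<open>Counting components on one large circle\<close>

context
  fixes n i :: nat and r \<epsilon> :: real
  assumes r: "0 < r" "\<rho> n \<le> r" "r < \<rho> (Suc n)"
    and i: "i \<le> n" "\<And>k. k \<le> n \<Longrightarrow> height k r \<le> height i r"
    and eps: "4 * (1/2) ^ n < \<epsilon>" "height i r \<ge> 4 + \<epsilon>"
begin

abbreviation "peak j \<equiv> of_real r * dir (i, j)"

lemma peak_active: "j < i \<Longrightarrow> (i, j) \<in> active n"
  using i(1) by (auto simp: active_def)

lemma norm_F_off:
  assumes "norm z = r" "\<And>p. p \<in> active n \<Longrightarrow> z \<notin> ball (of_real r * dir p) (s n * r)"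
  shows "norm (F z) \<le> 2 * (1/2) ^ n"
  using F_approx[of n z "{}"] assms r by (fastforce simp: dist_commute not_less)

lemma dist_dir_scaled: "dist (of_real r * x) (of_real r * y) = r * dist x y" for x y :: complex
  using r by (simp add: dist_norm norm_mult flip: right_diff_distrib)

text \<open>The factor 2 in \<open>sep_dir\<close> makes the distance of the centres at least the
  sum of the radii.\<close>

lemma balls_disjoint:
  assumes "p \<in> active n" "q \<in> active n" "p \<noteq> q"
  shows "ball (of_real r * dir p) (s n * r) \<inter> ball (of_real r * dir q) (s n * r) = {}"
proof -
  have "r * (2 * s n) \<le> dist (of_real r * dir p) (of_real r * dir q)"
    unfolding dist_dir_scaled using sep_dir[OF assms] r by (intro mult_left_mono) auto
  then show ?thesis by (intro disjoint_ballI) (simp add: algebra_simps)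
qed

lemma norm_F_on:
  assumes "norm z = r" "p \<in> active n" "z \<in> ball (of_real r * dir p) (s n * r)"
  shows "norm (F z - summand p z) \<le> 2 * (1/2) ^ n"
proof -
  have "s n * norm z \<le> dist z (of_real (norm z) * dir q)" if "q \<in> active n - {p}" for q
  proof -
    have "z \<notin> ball (of_real r * dir q) (s n * r)"
      using balls_disjoint[of p q] assms that by blast
    then show ?thesis using assms(1) by (simp add: dist_commute)
  qed
  then show ?thesis using F_approx[of n z "{p}"] assms r by auto
qed

lemma norm_F_peak:
  assumes "j < i"
  shows "norm (F (peak j)) \<ge> height i r - 2 * (1/2) ^ n"
proof -
  have "norm (F (peak j) - summand (i, j) (peak j)) \<le> 2 * (1/2) ^ n"
    using r sep_pos[of n] by (intro norm_F_on peak_active assms) (auto simp: norm_mult)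
  then show ?thesis
    using norm_triangle_ineq3[of "F (peak j)" "summand (i, j) (peak j)"]
      norm_summand_dir[of "(i, j)" r] by simp
qed

text \<open>Inside a tract a single summand matters, and its height is at most that of the dominant
  group; elsewhere \<open>F\<close> is small.\<close>

lemma norm_F_le:
  assumes "norm z = r"
  shows "norm (F z) \<le> height i r + 2 * (1/2) ^ n"
proof (cases "\<exists>p\<in>active n. z \<in> ball (of_real r * dir p) (s n * r)")
  case True
  then obtain p where p: "p \<in> active n" "z \<in> ball (of_real r * dir p) (s n * r)" by blast
  have "norm (F z) \<le> norm (summand p z) + 2 * (1/2) ^ n"
    using norm_F_on[OF assms p] norm_triangle_ineq2[of "F z" "summand p z"] by linarith
  also have "norm (summand p z) \<le> height i r"
    using norm_summand_le[of p z] i(2)[of "fst p"] p assms by (auto simp: active_def)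
  finally show ?thesis by simp
next
  case False
  moreover have "height i r \<ge> 0" using coeff_pos[of i] by (simp add: height_def)
  ultimately show ?thesis using norm_F_off[OF assms] by fastforce
qed

lemma max_modulus_F_le: "max_modulus F r \<le> height i r + 2 * (1/2) ^ n"
proof -
  obtain z where "z \<in> sphere 0 r" "norm (F z) = max_modulus F r"
    using max_modulus_is_max(1)[OF continuous_on_F, of r] r by auto
  then show ?thesis using norm_F_le[of z] by simp
qed

lemma max_modulus_F_ge:
  assumes "0 < i"
  shows "max_modulus F r \<ge> height i r - 2 * (1/2) ^ n"
proof -
  have "norm (F (peak 0)) \<le> max_modulus F r"
    using r by (intro max_modulus_is_max(2)[OF continuous_on_F]) (auto simp: norm_mult)
  then show ?thesis using norm_F_peak[OF assms] by linarith
qed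

lemma half_power_le: "(1/2::real) ^ n \<le> 1"
  by (simp add: power_le_one)

text \<open>The peaks differ from the maximum by at most \<open>4 * (1/2) ^ n\<close>, which is
  below \<open>\<epsilon>\<close>. As the height is at least \<open>4 + \<epsilon>\<close>, the
  threshold exceeds the values of \<open>F\<close> off all tracts, so the set lies in disjoint
  balls, one per tract.\<close>

lemma v_F_ge: "enat i \<le> v F r \<epsilon>"
proof -
  let ?S = "{z. norm z = r \<and> norm (F z) > max_modulus F r - \<epsilon>}"
  let ?B = "\<lambda>p. ball (of_real r * dir p) (s n * r)"
  have "enat (card {..<i}) \<le> num_components ?S"
  proof (rule num_components_ge[where p = peak])
    fix j assume "j \<in> {..<i}"
    then show "peak j \<in> ?S"
      using norm_F_peak[of j] max_modulus_F_le eps r by (auto simp: norm_mult)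
  next
    fix j k C
    assume jk: "j \<in> {..<i}" "k \<in> {..<i}" "j \<noteq> k" and C: "connected C" "C \<subseteq> ?S" "peak j \<in> C"
    let ?V = "\<Union>p\<in>active n - {(i, j)}. ?B p"
    have "max_modulus F r - \<epsilon> \<ge> 2 * (1/2) ^ n"
      using max_modulus_F_ge jk eps half_power_le by fastforce
    \<comment> \<open>The ball of one peak and the union of the other balls are disjoint open sets
      covering \<open>C\<close>, so \<open>C\<close> misses one of them.\<close>
    then have "C \<subseteq> ?B (i, j) \<union> ?V"
      using C(2) norm_F_off by fastforce
    moreover have "?B (i, j) \<inter> ?V \<inter> C = {}"
      using balls_disjoint[OF peak_active[of j]] jk by fastforce
    ultimately have "?B (i, j) \<inter> C = {} \<or> ?V \<inter> C = {}"
      using C(1) by (intro connectedD) auto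
    moreover have "peak l \<in> ?B (i, l)" for l
      using r sep_pos[of n] by simp
    moreover have "(i, k) \<in> active n - {(i, j)}"
      using jk peak_active[of k] by simp
    ultimately show "peak k \<notin> C" using C(3) by blast
  qed simp
  then show ?thesis by (simp add: v_def)
qed

text \<open>Turning the axes of group \<open>i\<close> by \<open>\<gamma> n\<close> gives points off
  all tracts, where \<open>F\<close> is small. Two such points are separated on both arcs by peaks,
  where the modulus of \<open>F\<close> is at least \<open>\<epsilon>\<close>.\<close>

lemma w_F_ge: "enat i \<le> w F r \<epsilon>"
proof -
  let ?S = "{z. norm z = r \<and> norm (F z) < \<epsilon>}"
  let ?q = "\<lambda>j. of_real r * cis (angle (i, j) + \<gamma> n)"
  have "enat (card {..<i}) \<le> num_components ?S"
  proof (rule num_components_ge[where p = ?q])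
    fix j assume "j \<in> {..<i}"
    then have j: "(i, j) \<in> active n" using peak_active by simp
    have "?q j \<notin> ball (of_real r * dir p) (s n * r)" if "p \<in> active n" for p
    proof -
      have "r * s n \<le> dist (?q j) (of_real r * dir p)"
        unfolding dist_dir_scaled using sep_gap[OF j that] r by (intro mult_left_mono) auto
      then show ?thesis by (simp add: dist_commute mult.commute)
    qed
    then have "norm (F (?q j)) \<le> 2 * (1/2) ^ n"
      using r by (intro norm_F_off) (auto simp: norm_mult)
    also have "\<dots> < \<epsilon>" using eps(1) zero_le_power[of "1/2::real" n] by linarith
    finally show "?q j \<in> ?S" using r by (simp add: norm_mult)
  next
    have separated: "?q j \<notin> C \<or> ?q k \<notin> C"
      if jk: "j < i" "k < i" "angle (i, j) < angle (i, k)" and C: "connected C" "C \<subseteq> ?S" for j k C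
    proof -
      have avoid: "peak l \<notin> C" if "l < i" for l
        using norm_F_peak[OF that] C(2) eps half_power_le by fastforce
      have gap': "angle (i, j) + \<gamma> n < angle (i, k)"
        using gap peak_active jk by blast
      have "?q k \<notin> C" if "?q j \<in> C"
      \<comment> \<open>The chord joins peaks \<open>j\<close> and \<open>k\<close>: the point
        \<open>?q j\<close> lies on the arc from peak \<open>j\<close> to peak \<open>k\<close>, and
        \<open>?q k\<close> lies beyond peak \<open>k\<close> within one turn.\<close>
      proof (rule connected_subset_circle_avoiding[where a = "angle (i, j)" and b = "angle (i, k)"
            and \<phi> = "angle (i, j) + \<gamma> n", OF r(1) C(1)])
        show "angle (i, k) + \<gamma> n < angle (i, j) + 2 * pi"
          using angle_le_1[of "(i, k)"] gap_le_1[of n] angle_pos[of "(i, j)"] pi_gt3 by linarith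
      qed (use C avoid jk gap' gap_pos[of n] that in \<open>auto simp: dir_def\<close>)
      then show ?thesis by blast
    qed
    fix j k C
    assume "j \<in> {..<i}" "k \<in> {..<i}" "j \<noteq> k" "connected C" "C \<subseteq> ?S" "?q j \<in> C"
    then show "?q k \<notin> C"
      using separated[of j k C] separated[of k j C] angle_eq_iff[of "(i, j)" "(i, k)"]
      by (cases "angle (i, j) < angle (i, k)") auto
  qed simp
  then show ?thesis by (simp add: w_def)
qed

end

lemma eventually_components_ge:
  assumes "\<epsilon> > 0"
  shows "\<forall>\<^sub>F r in at_top. enat K \<le> v F r \<epsilon> \<and> enat K \<le> w F r \<epsilon>"
proof -
  have "\<forall>\<^sub>F m in sequentially. 4 * (1/2) ^ m < \<epsilon>"
    using assms by real_asymp
  then obtain m where m: "4 * (1/2) ^ m < \<epsilon>"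
    by (meson eventually_sequentially order_refl)
  show ?thesis
    \<comment> \<open>An index \<open>i \<ge> K\<close> gives enough components, and
      \<open>n \<ge> i \<ge> m\<close> makes the approximation error small against
      \<open>\<epsilon>\<close>.\<close>
    using eventually_dominant[of "max K m" "4 + \<epsilon>"] eventually_gt_at_top[of 0]
  proof eventually_elim
    case (elim r)
    then obtain n i where ni: "\<rho> n \<le> r" "r < \<rho> (Suc n)" "max K m \<le> i" "i \<le> n"
      "\<And>k. k \<le> n \<Longrightarrow> height k r \<le> height i r" "4 + \<epsilon> \<le> height i r" by blast
    have "(1/2::real) ^ n \<le> (1/2) ^ m" using ni by (intro power_decreasing) auto
    then have "4 * (1/2) ^ n < \<epsilon>" using m by linarith
    then have "enat i \<le> v F r \<epsilon>" "enat i \<le> w F r \<epsilon>"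
      using ni elim by (auto intro!: v_F_ge[of r n i \<epsilon>] w_F_ge[of r n i \<epsilon>])
    moreover have "enat K \<le> enat i" using ni by simp
    ultimately show ?case by (meson order_trans)
  qed
qed

end

section \<open>Choice of the parameters\<close>

lemma tract_sum_exists: "\<exists>\<delta> \<rho> s \<gamma>. tract_sum \<delta> \<rho> s \<gamma>"
proof -
  \<comment> \<open>The order of choice is \<open>\<gamma>\<close>, \<open>s\<close>,
    \<open>\<rho>\<close>, \<open>\<delta>\<close>, each depending only on the earlier ones. Half
    the minimal distance of the active angles leaves the gap strict.\<close>
  have "\<exists>\<gamma>>0. \<gamma> \<le> 1 \<and> (\<forall>p\<in>active n. \<forall>q\<in>active n. angle p < angle q \<longrightarrow> angle p + \<gamma> < angle q)" for n
  proof -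
    obtain d where d: "d > 0" "\<And>a b. a \<in> angle ` active n \<Longrightarrow> b \<in> angle ` active n \<Longrightarrow> a \<noteq> b \<Longrightarrow> d \<le> dist a b"
      using finite_set_separated[of "angle ` active n"] finite_active by blast
    have "angle p + min 1 (d / 2) < angle q" if "p \<in> active n" "q \<in> active n" "angle p < angle q" for p q
    proof -
      have "d \<le> dist (angle p) (angle q)" using that by (intro d(2)) auto
      then show ?thesis using that d(1) by (simp add: dist_real_def)
    qed
    then show ?thesis using d(1) by (intro exI[of _ "min 1 (d / 2)"]) auto
  qed
  then obtain \<gamma> where \<gamma>: "\<And>n. \<gamma> n > 0" "\<And>n. \<gamma> n \<le> 1"
    "\<And>n p q. p \<in> active n \<Longrightarrow> q \<in> active n \<Longrightarrow> angle p < angle q \<Longrightarrow> angle p + \<gamma> n < angle q"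
    by metis
  have "\<exists>s>0. (\<forall>p\<in>active n. \<forall>q\<in>active n. p \<noteq> q \<longrightarrow> 2 * s \<le> dist (dir p) (dir q)) \<and>
      (\<forall>p\<in>active n. \<forall>q\<in>active n. s \<le> dist (cis (angle p + \<gamma> n)) (dir q))" for n
  proof -
    \<comment> \<open>One separation constant serves both the axes and the rotated axes. A rotated
      axis never meets an axis: its angle falls strictly before the next active angle.\<close>
    let ?A = "dir ` active n \<union> (\<lambda>p. cis (angle p + \<gamma> n)) ` active n"
    obtain d where d: "d > 0" "\<And>a b. a \<in> ?A \<Longrightarrow> b \<in> ?A \<Longrightarrow> a \<noteq> b \<Longrightarrow> d \<le> dist a b"
      using finite_set_separated[of ?A] finite_active by blast
    have inj: "dir p \<noteq> dir q" if "p \<noteq> q" for p q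
    proof
      assume "dir p = dir q"
      then have "angle p = angle q"
        using angle_pos[of p] angle_pos[of q] angle_le_1[of p] angle_le_1[of q] pi_gt3
        by (intro cis_inj) (auto simp: dir_def)
      then show False using that by (simp add: angle_eq_iff)
    qed
    have "cis (angle p + \<gamma> n) \<noteq> dir q" if "p \<in> active n" "q \<in> active n" for p q
    proof
      assume "cis (angle p + \<gamma> n) = dir q"
      then have "angle p + \<gamma> n = angle q"
        using angle_pos[of p] angle_pos[of q] angle_le_1[of p] angle_le_1[of q] pi_gt3 \<gamma>(1,2)[of n]
        by (intro cis_inj) (auto simp: dir_def)
      then show False using \<gamma>(1)[of n] \<gamma>(3)[OF that] by simp
    qed
    then have "\<forall>p\<in>active n. \<forall>q\<in>active n. d \<le> dist (cis (angle p + \<gamma> n)) (dir q)"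
      using d(2) by blast
    moreover have "\<forall>p\<in>active n. \<forall>q\<in>active n. p \<noteq> q \<longrightarrow> d \<le> dist (dir p) (dir q)"
      using d(2) inj by blast
    ultimately show ?thesis using d(1) by (intro exI[of _ "d / 2"]) fastforce
  qed
  then obtain s where s: "\<And>n. s n > 0"
    "\<And>n p q. p \<in> active n \<Longrightarrow> q \<in> active n \<Longrightarrow> p \<noteq> q \<Longrightarrow> 2 * s n \<le> dist (dir p) (dir q)"
    "\<And>n p q. p \<in> active n \<Longrightarrow> q \<in> active n \<Longrightarrow> s n \<le> dist (cis (angle p + \<gamma> n)) (dir q)"
    by metis
  have "\<exists>R. \<forall>z. R \<le> norm z \<longrightarrow> s n * norm z \<le> norm (z - of_real (norm z)) \<longrightarrow>
      norm (tract_fun z) \<le> (1/2) ^ n / (real (card (active n)) + 1)" for n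
    by (rule tract_fun_decay[OF s(1)[of n], of "(1/2) ^ n / (real (card (active n)) + 1)"])
      (auto simp: add_nonneg_pos)
  then obtain R where R: "\<And>n z. R n \<le> norm z \<Longrightarrow> s n * norm z \<le> norm (z - of_real (norm z)) \<Longrightarrow>
      norm (tract_fun z) \<le> (1/2) ^ n / (real (card (active n)) + 1)"
    by metis
  \<comment> \<open>The summand \<open>n\<close> makes the radii unbounded, and summing all earlier
    \<open>\<bar>R i\<bar>\<close> makes them monotone while keeping them above
    \<open>R n\<close>.\<close>
  define \<rho> where "\<rho> n = real n + (\<Sum>i\<le>n. \<bar>R i\<bar>)" for n
  have "mono \<rho>" unfolding \<rho>_def mono_iff_le_Suc by simp
  have R_le: "R n \<le> \<rho> n" for n
    using member_le_sum[of n "{..n}" "\<lambda>i. \<bar>R i\<bar>"] unfolding \<rho>_def by simp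
  have "\<exists>\<delta>>0. \<delta> \<le> 1 \<and> (\<forall>z. norm z \<le> \<rho> i \<longrightarrow> \<delta> * norm (ray_group i z) \<le> (1/2) ^ i)" for i
  proof -
    \<comment> \<open>The group is bounded by some \<open>C\<close> on the disc of radius
      \<open>\<rho> i\<close>; dividing by \<open>C + 1\<close> also keeps the coefficient below
      1.\<close>
    have "compact (ray_group i ` cball 0 (\<rho> i))"
      by (intro compact_continuous_image compact_cball
          continuous_on_subset[OF holomorphic_on_imp_continuous_on[OF ray_group_holomorphic] subset_UNIV])
    then obtain C where C: "C > 0" "\<And>z. norm z \<le> \<rho> i \<Longrightarrow> norm (ray_group i z) \<le> C"
      using compact_imp_bounded[of "ray_group i ` cball 0 (\<rho> i)"] by (auto simp: bounded_pos)
    have "(1/2) ^ i / (C + 1) * norm (ray_group i z) \<le> (1/2) ^ i" if "norm z \<le> \<rho> i" for z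
    proof -
      have "norm (ray_group i z) / (C + 1) \<le> 1"
        using C(1) C(2)[OF that] by (simp add: divide_le_eq)
      from mult_left_mono[OF this, of "(1/2) ^ i"] show ?thesis by simp
    qed
    moreover have "(1/2::real) ^ i \<le> 1" by (simp add: power_le_one)
    then have "(1/2) ^ i / (C + 1) \<le> 1" using C(1) by (simp add: divide_le_eq)
    ultimately show ?thesis using C(1) by (intro exI[of _ "(1/2) ^ i / (C + 1)"]) auto
  qed
  then obtain \<delta> where \<delta>: "\<And>i. \<delta> i > 0" "\<And>i. \<delta> i \<le> 1"
    "\<And>i z. norm z \<le> \<rho> i \<Longrightarrow> \<delta> i * norm (ray_group i z) \<le> (1/2) ^ i"
    by metis
  have "tract_sum \<delta> \<rho> s \<gamma>"
  proof
    show "real n \<le> \<rho> n" for n by (simp add: \<rho>_def sum_nonneg)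
    show "norm (tract_fun z) \<le> (1/2) ^ n / (real (card (active n)) + 1)"
      if "\<rho> n \<le> norm z" "s n * norm z \<le> norm (z - of_real (norm z))" for n z
      using R[OF order_trans[OF R_le that(1)] that(2)] .
  qed (fact \<gamma> s \<delta> \<open>mono \<rho>\<close>)+
  then show ?thesis by blast
qed

theorem theorem1p2:
  "\<exists>f::complex \<Rightarrow> complex. f holomorphic_on UNIV \<and>
     (\<forall>\<epsilon>>0. ((\<lambda>r. v f r \<epsilon>) \<longlongrightarrow> \<infinity>) at_top \<and>
             ((\<lambda>r. w f r \<epsilon>) \<longlongrightarrow> \<infinity>) at_top)"
proof -
  obtain \<delta> \<rho> s \<gamma> where "tract_sum \<delta> \<rho> s \<gamma>" using tract_sum_exists by blast
  then interpret tract_sum \<delta> \<rho> s \<gamma> .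
  have lim: "(g \<longlongrightarrow> \<infinity>) at_top" if "\<And>K. \<forall>\<^sub>F r in at_top. enat K \<le> g r" for g :: "real \<Rightarrow> enat"
  proof (rule order_tendstoI)
    fix a :: enat assume "a < \<infinity>"
    \<comment> \<open>Exceeding \<open>enat k\<close> strictly means reaching
      \<open>enat (Suc k)\<close>.\<close>
    then obtain k where "a = enat k" by auto
    then show "\<forall>\<^sub>F r in at_top. a < g r"
      using that[of "Suc k"] by (auto elim!: eventually_mono simp: Suc_ile_eq)
  qed auto
  have "((\<lambda>r. v F r \<epsilon>) \<longlongrightarrow> \<infinity>) at_top \<and> ((\<lambda>r. w F r \<epsilon>) \<longlongrightarrow> \<infinity>) at_top" if "\<epsilon> > 0" for \<epsilon>
    using eventually_components_ge[OF that] by (intro conjI lim) (simp_all add: eventually_conj_iff)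
  then show ?thesis using F_holomorphic by blast
qed

end
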